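(* For $0 \leq \gamma < 1$ let $U_\gamma$ be the operator given by $$(U_{\gamma}b)(j) = \sum_{i \in \mathbb{Z},\, i \neq \pm j} \frac{b(i)}{|i-j|^{\frac{1-\gamma}{2}} |i+j|^{\frac{1-\gamma}{2}}}, \qquad j \in \mathbb{Z}.$$ There exists $\epsilon \in \left(0, \frac{1}{3}\right)$ such that, for every $0 \leq \gamma < \epsilon$, the operator $U_{\gamma}$ is not bounded from $H^{p}(\mathbb{Z})$ into $H^{q}(\mathbb{Z})$ for any $p$ with $0 < p \leq \frac{1}{1+\gamma}$, where $q$ is given by $\frac{1}{q} = \frac{1}{p} - \gamma$.
   Context: Sequences $b = \{b(i)\}_{i \in \mathbb{Z}}$ are complex-valued. For $0 < p < \infty$, $\|b\|_{\ell^p(\mathbb{Z})} = \left( \sum_{i \in \mathbb{Z}} |b(i)|^p \right)^{1/p}$, and $b \in \ell^p(\mathbb{Z})$ means $\|b\|_{\ell^p(\mathbb{Z})} < +\infty$. The discrete Hilbert transform $H$ of a sequence $b$ is $$(Hb)(j) = \frac{1}{\pi} \sum_{i=-\infty}^{\infty} \frac{b(i)}{j+i+\frac{1}{2}}, \qquad j \in \mathbb{Z}.$$ The discrete Hardy space $H^{p}(\mathbb{Z})$, $0 < p < \infty$, consists of all sequences $b \in \ell^{p}(\mathbb{Z})$ with $Hb \in \ell^{p}(\mathbb{Z})$, and its "norm" is $\| b \|_{H^{p}(\mathbb{Z})} = \| b \|_{\ell^{p}(\mathbb{Z})} + \| Hb \|_{\ell^{p}(\mathbb{Z})}$. An operator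 $U$ is bounded from $H^p(\mathbb{Z})$ into $H^q(\mathbb{Z})$ if $Ub \in H^q(\mathbb{Z})$ for all $b \in H^p(\mathbb{Z})$ and there is a constant $C$ with $\|Ub\|_{H^q(\mathbb{Z})} \leq C \|b\|_{H^p(\mathbb{Z})}$ for all $b \in H^p(\mathbb{Z})$. *)

theory Defs
  imports "HOL-Analysis.Analysis"
begin

definition lp_space :: "real \<Rightarrow> (int \<Rightarrow> complex) set" where
  "lp_space p = {b. (\<lambda>i. norm (b i) powr p) summable_on UNIV}"

definition lp_norm :: "real \<Rightarrow> (int \<Rightarrow> complex) \<Rightarrow> real" where
  "lp_norm p b = (\<Sum>\<^sub>\<infinity>i\<in>UNIV. norm (b i) powr p) powr (1 / p)"

text \<open>
  The value of an unconditional sum \<open>infsum\<close> defaults to 0 when the family is not summable.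
  For a sequence in an \<open>\<ell>\<^sup>p\<close> space with \<open>0 < p\<close> the series below converges
  absolutely (Hoelder), so the default plays no role in \<open>Hardy_space\<close>, where membership
  in \<open>\<ell>\<^sup>p\<close> is required as well.
\<close>

definition discrete_Hilbert :: "(int \<Rightarrow> complex) \<Rightarrow> int \<Rightarrow> complex" where
  "discrete_Hilbert b j =
     (1 / of_real pi) * (\<Sum>\<^sub>\<infinity>i\<in>UNIV. b i / (of_int j + of_int i + 1 / 2))"

definition Hardy_space :: "real \<Rightarrow> (int \<Rightarrow> complex) set" where
  "Hardy_space p = {b. b \<in> lp_space p \<and> discrete_Hilbert b \<in> lp_space p}"

definition Hardy_norm :: "real \<Rightarrow> (int \<Rightarrow> complex) \<Rightarrow> real" where
  "Hardy_norm p b = lp_norm p b + lp_norm p (discrete_Hilbert b)"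

definition Hardy_bounded ::
  "real \<Rightarrow> real \<Rightarrow> ((int \<Rightarrow> complex) \<Rightarrow> (int \<Rightarrow> complex)) \<Rightarrow> bool" where
  "Hardy_bounded p q T \<longleftrightarrow>
     (\<forall>b \<in> Hardy_space p. T b \<in> Hardy_space q) \<and>
     (\<exists>C::real. \<forall>b \<in> Hardy_space p. Hardy_norm q (T b) \<le> C * Hardy_norm p b)"

text \<open>
  On \<open>\<ell>\<^sup>p\<close> with \<open>0 < p \<le> 1\<close> and for \<open>\<gamma> \<le> 1\<close> this series
  converges absolutely, since its weights are at most 1.
\<close>

definition U_op :: "real \<Rightarrow> (int \<Rightarrow> complex) \<Rightarrow> int \<Rightarrow> complex" where
  "U_op \<gamma> b j =
     (\<Sum>\<^sub>\<infinity>i\<in>{i. i \<noteq> j \<and> i \<noteq> - j}.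
        b i / of_real (real_of_int \<bar>i - j\<bar> powr ((1 - \<gamma>) / 2)
                     * real_of_int \<bar>i + j\<bar> powr ((1 - \<gamma>) / 2)))"

end

theory Submission imports Defs "HOL-Real_Asymp.Real_Asymp"
begin

text \<open>
  The obstruction is a missing cancellation. If \<open>q \<le> 1\<close> and both \<open>f\<close> and \<open>H f\<close> are in
  \<open>\<ell>\<^sup>q\<close>, then \<open>f\<close> has sum zero, because \<open>H f j\<close> behaves like \<open>(\<Sum> f) / (\<pi> j)\<close> at infinity
  and the harmonic series diverges (\<open>sum_zero_of_discrete_Hilbert_in_lp\<close>; here \<open>f\<close> decays
  fast enough for an elementary proof). The condition \<open>p \<le> 1 / (1 + \<gamma>)\<close> says exactly that
  \<open>q \<le> 1\<close>. So a bounded \<open>U\<^sub>\<gamma>\<close> would send every element of \<open>H\<^sup>p\<close> to a sequence with sum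
  zero.

  Put \<open>s = (1 - \<gamma>) / 2\<close> and \<open>K i j = \<bar>i\<^sup>2 - j\<^sup>2\<bar> powr - s\<close>, zero on the diagonals. The row sums
  \<open>\<Sum>j. K i j\<close> diverge, but \<open>d i = (\<Sum>j. K i j - K 0 j)\<close> converges, and for a finitely supported
  \<open>b\<close> with \<open>\<Sum> b = 0\<close> the sum of \<open>U\<^sub>\<gamma> b\<close> is \<open>\<Sum>i. b i * d i\<close>. Take for \<open>b\<close> the coefficients of an
  \<open>M\<close>-th finite difference at an arbitrary integer \<open>a\<close>. Its \<open>M\<close> vanishing moments give
  \<open>H b j = O(\<bar>j\<bar> powr - (M + 1))\<close>, so \<open>b\<close> is in \<open>H\<^sup>p\<close> as soon as \<open>(M + 1) * p > 1\<close>. For such an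
  \<open>M\<close>, boundedness forces all \<open>M\<close>-th differences of \<open>d\<close> to vanish: \<open>d\<close> is a polynomial.

  This is impossible however small \<open>p\<close>, and hence however large \<open>M\<close>, is. Since \<open>d i\<close> grows at most
  like \<open>\<bar>i\<bar> powr (3/2)\<close> (\<open>defect_growth\<close>), the polynomial is affine
  (\<open>subquadratic_fdiff_zero\<close>). But \<open>d\<close> is even with \<open>d 0 = 0\<close>, so it would vanish identically,
  whereas \<open>d 1 < 0\<close> (\<open>defect_1_neg\<close>): passing from row \<open>0\<close> to row \<open>1\<close> replaces one excluded
  column by two, and this loss outweighs the gain in the other columns.
\<close>

section \<open>Finite differences\<close>

primrec fdiff :: "nat \<Rightarrow> (int \<Rightarrow> 'a::ab_group_add) \<Rightarrow> int \<Rightarrow> 'a" where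
  "fdiff 0 f = f"
| "fdiff (Suc M) f = (\<lambda>a. fdiff M f (a + 1) - fdiff M f a)"

lemma fdiff_add: "fdiff (m + n) f = fdiff m (fdiff n f)"
  by (induction m) auto

lemma fdiff_additive:
  assumes "\<And>x y. h (x - y) = h x - h y"
  shows "h (fdiff M f a) = fdiff M (\<lambda>i. h (f i)) a"
  by (induction M arbitrary: a) (auto simp: assms)

lemma fdiff_Suc_minus_const: "fdiff (Suc M) (\<lambda>i. f i - c) a = fdiff (Suc M) f a"
proof -
  have "fdiff M (\<lambda>i. f i - c) a = fdiff M f a - (if M = 0 then c else 0)" for a
    by (induction M arbitrary: a) auto
  then show ?thesis by simp
qed

lemma has_sum_fdiff:
  fixes F :: "int \<Rightarrow> 'b \<Rightarrow> 'a::real_normed_vector"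
  assumes "\<And>i. ((\<lambda>j. F i j) has_sum S i) A"
  shows "((\<lambda>j. fdiff M (\<lambda>i. F i j) a) has_sum fdiff M S a) A"
proof (induction M arbitrary: a)
  case (Suc M)
  have "((\<lambda>j. fdiff M (\<lambda>i. F i j) (a + 1) + - fdiff M (\<lambda>i. F i j) a)
          has_sum (fdiff M S (a + 1) + - fdiff M S a)) A"
    by (intro has_sum_add) (simp_all add: has_sum_uminus Suc)
  then show ?case by simp
qed (use assms in simp)

lemma fdiff_norm_bound:
  fixes F :: "int \<Rightarrow> 'b \<Rightarrow> 'a::real_normed_vector"
  assumes "\<And>i. \<exists>C. \<forall>j. norm (F i j) \<le> C * g j"
  shows "\<exists>C. \<forall>j. norm (fdiff M (\<lambda>i. F i j) a) \<le> C * g j"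
proof (induction M arbitrary: a)
  case (Suc M)
  obtain C1 C2 where 1: "\<And>j. norm (fdiff M (\<lambda>i. F i j) (a+1)) \<le> C1 * g j"
    and 2: "\<And>j. norm (fdiff M (\<lambda>i. F i j) a) \<le> C2 * g j"
    using Suc[of "a+1"] Suc[of a] by auto
  have "norm (fdiff (Suc M) (\<lambda>i. F i j) a) \<le> (C1 + C2) * g j" for j
    using norm_triangle_ineq4[of "fdiff M (\<lambda>i. F i j) (a+1)" "fdiff M (\<lambda>i. F i j) a"] 1[of j] 2[of j]
    by (simp add: algebra_simps)
  then show ?case by blast
qed (use assms in simp)

text \<open>
  The classical partial fraction identity; the extra \<open>M\<close> factors in the denominator are the gain
  in decay that vanishing moments bring to the Hilbert transform.
\<close>

lemma fdiff_inverse_shift: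
  fixes x :: "'a::field_char_0"
  assumes "\<And>i. x + of_int i \<noteq> 0"
  shows "fdiff M (\<lambda>i. 1 / (x + of_int i)) a = (-1) ^ M * fact M / pochhammer (x + of_int a) (Suc M)"
proof (induction M arbitrary: a)
  case (Suc M)
  define y where "y = x + of_int a"
  have nz: "y + of_nat k \<noteq> 0" for k
    using assms[of "a + int k"] by (simp add: y_def add.assoc)
  have nzp: "pochhammer y n \<noteq> 0" for n
    using nz by (auto simp: pochhammer_eq_0_iff) (metis add_eq_0_iff nz)
  have nz': "pochhammer (y + 1) n \<noteq> 0" for n
    using nzp[of "Suc n"] by (simp add: pochhammer_rec)
  have e1: "pochhammer y (Suc (Suc M)) = y * pochhammer (y + 1) (Suc M)"
    by (rule pochhammer_rec)
  have e2: "pochhammer y (Suc (Suc M)) = (y + of_nat (Suc M)) * pochhammer y (Suc M)"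
    by (rule pochhammer_rec')
  have i1: "1 / pochhammer (y + 1) (Suc M) = y / pochhammer y (Suc (Suc M))"
    unfolding e1 using nz[of 0] by simp
  have i2: "1 / pochhammer y (Suc M) = (y + of_nat (Suc M)) / pochhammer y (Suc (Suc M))"
    unfolding e2 using nz[of "Suc M"] by simp
  have "fdiff (Suc M) (\<lambda>i. 1 / (x + of_int i)) a
      = (-1) ^ M * fact M * (1 / pochhammer (y + 1) (Suc M) - 1 / pochhammer y (Suc M))"
    by (simp add: Suc y_def add.assoc right_diff_distrib)
  also have "\<dots> = (-1) ^ M * fact M * (- of_nat (Suc M) / pochhammer y (Suc (Suc M)))"
    unfolding i1 i2 by (simp add: diff_divide_distrib [symmetric])
  also have "\<dots> = (-1) ^ Suc M * fact (Suc M) / pochhammer y (Suc (Suc M))"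
    by (simp add: algebra_simps del: pochhammer_Suc)
  finally show ?case by (simp only: y_def)
qed simp

section \<open>Weights on the integers\<close>

definition wt :: "int \<Rightarrow> real" where
  "wt j = 1 + real_of_int \<bar>j\<bar>"

lemma wt_ge_1: "1 \<le> wt j" and wt_pos: "0 < wt j" and wt_nz: "wt j \<noteq> 0"
  and wt_nonneg: "0 \<le> wt j"
  by (auto simp: wt_def)

lemma wt_ratio_powr: "(wt i / wt j) powr r = wt i powr r * wt j powr - r"
  by (simp add: powr_divide wt_nonneg powr_minus_divide)

lemma wt_succ: "wt (i + 1) \<le> 2 * wt i"
  by (auto simp: wt_def)

lemma half_le_abs: "1 / 2 \<le> \<bar>real_of_int j + real_of_int i + 1 / 2\<bar>"
proof -
  have "j + i \<ge> 0 \<or> j + i \<le> -1" by linarith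
  then have "real_of_int (j + i) \<ge> 0 \<or> real_of_int (j + i) \<le> -1" by linarith
  then show ?thesis by auto
qed

text \<open>
  Peetre's inequality. It lets the decay in \<open>j\<close> of the Hilbert kernel be bought at the price of a
  weight in \<open>i\<close>, uniformly in both variables.
\<close>

lemma inverse_half_shift_le: "1 / \<bar>real_of_int j + real_of_int i + 1 / 2\<bar> \<le> 4 * (wt i / wt j)"
proof -
  define x where "x = \<bar>real_of_int j + real_of_int i + 1 / 2\<bar>"
  have x: "1/2 \<le> x" using half_le_abs x_def by auto
  have "wt j \<le> 1/2 + x + wt i"
    unfolding x_def wt_def by auto
  also have "1/2 + x + wt i \<le> x * wt i + x * wt i + 2 * x * wt i"
  proof -
    have "x \<le> x * wt i" using x wt_ge_1[of i] by (simp add: mult_le_cancel_left1)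
    moreover have "wt i \<le> 2 * x * wt i" using x wt_pos[of i] by (simp add: mult_le_cancel_right1)
    moreover have "1/2 \<le> x * wt i" using calculation(1) x by linarith
    ultimately show ?thesis by linarith
  qed
  finally have "wt j \<le> 4 * x * wt i" by simp
  then show ?thesis unfolding x_def[symmetric] using x wt_pos[of j]
    by (simp add: field_simps)
qed

lemma has_sum_int_even:
  fixes f :: "int \<Rightarrow> real"
  assumes even: "\<And>j. f (- j) = f j" and S: "((\<lambda>n. f (int (Suc n))) has_sum S) UNIV"
  shows "(f has_sum (f 0 + 2 * S)) UNIV"
proof -
  let ?P = "range (\<lambda>n. int (Suc n))" and ?N = "range (\<lambda>n. - int (Suc n))"
  have P: "(f has_sum S) ?P"
    using S by (subst has_sum_reindex) (auto simp: inj_on_def o_def)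
  have N: "(f has_sum S) ?N"
    using S by (subst has_sum_reindex) (auto simp: inj_on_def o_def even simp del: of_nat_Suc)
  have Z: "(f has_sum f 0) {0}" by (simp add: has_sum_finite_iff)
  have "(f has_sum (f 0 + (S + S))) ({0} \<union> (?P \<union> ?N))"
    by (intro has_sum_Un_disjoint P N Z) auto
  moreover have "{0} \<union> (?P \<union> ?N) = UNIV"
  proof (rule set_eqI)
    fix j :: int
    consider "j = 0" | "j = int (Suc (nat (j - 1)))" | "j = - int (Suc (nat (- j - 1)))"
      by linarith
    then show "j \<in> {0} \<union> (?P \<union> ?N) \<longleftrightarrow> j \<in> UNIV"
      by cases blast+
  qed
  ultimately show ?thesis by simp
qed

lemma wt_powr_summable:
  assumes "1 < r"
  shows "(\<lambda>j. wt j powr - r) summable_on UNIV"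
proof -
  have "summable (\<lambda>n. real n powr - r)"
    using assms by (simp add: summable_real_powr_iff)
  then have "summable (\<lambda>n. real (Suc (Suc n)) powr - r)"
    by (subst summable_Suc_iff, subst summable_Suc_iff)
  then have "(\<lambda>n. real (Suc (Suc n)) powr - r) summable_on UNIV"
    by (subst summable_on_UNIV_nonneg_real_iff) auto
  then obtain S where "((\<lambda>n. real (Suc (Suc n)) powr - r) has_sum S) UNIV"
    by (auto simp: summable_on_def)
  then have "((\<lambda>n. wt (int (Suc n)) powr - r) has_sum S) UNIV"
    by (simp add: wt_def)
  from has_sum_int_even[OF _ this] show ?thesis
    by (auto simp: summable_on_def wt_def)
qed

lemma wt_inverse_not_summable: "\<not> (\<lambda>j. 1 / wt j) summable_on UNIV"
proof
  assume "(\<lambda>j. 1 / wt j) summable_on UNIV"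
  then have "(\<lambda>j. 1 / wt j) summable_on (range int)"
    by (rule summable_on_subset) auto
  then have "(\<lambda>n. 1 / wt (int n)) summable_on UNIV"
    by (subst (asm) summable_on_reindex) (auto simp: o_def)
  then have "summable (\<lambda>n. 1 / wt (int n))"
    by (rule summable_on_imp_summable)
  then have "summable (\<lambda>n. real (Suc n) powr -1)"
    by (simp add: wt_def powr_minus_divide)
  then have "summable (\<lambda>n. real n powr -1)"
    by (subst (asm) summable_Suc_iff)
  then have "(-1::real) < -1"
    by (rule summable_real_powr_iff [THEN iffD1])
  then show False by simp
qed

section \<open>Sequences of subquadratic growth\<close>

lemma fdiff_growth:
  assumes e: "0 \<le> e" and "\<And>i. \<bar>f i\<bar> \<le> C * wt i powr e"
  shows "\<exists>C. \<forall>i. \<bar>fdiff M f i\<bar> \<le> C * wt i powr e"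
proof (induction M)
  case (Suc M)
  then obtain D where D: "\<And>i. \<bar>fdiff M f i\<bar> \<le> D * wt i powr e" by blast
  have D0: "D \<ge> 0" using D[of 0] by (auto simp: wt_def)
  have "\<bar>fdiff (Suc M) f i\<bar> \<le> (D * 2 powr e + D) * wt i powr e" for i
  proof -
    have "wt (i + 1) powr e \<le> (2 * wt i) powr e"
      using wt_succ e wt_pos by (intro powr_mono2) (auto intro: less_imp_le)
    then have "D * wt (i + 1) powr e \<le> D * (2 powr e * wt i powr e)"
      using D0 by (simp add: powr_mult mult_left_mono wt_nonneg)
    then show ?thesis using D[of i] D[of "i+1"] by (simp add: algebra_simps)
  qed
  then show ?case by blast
qed (use assms in auto)

text \<open>
  A constant second difference \<open>c\<close> makes \<open>f n\<close> a quadratic polynomial in \<open>n\<close> with leading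
  coefficient \<open>c / 2\<close>, which the growth bound rules out unless \<open>c = 0\<close>.
\<close>

lemma subquadratic_second_difference_zero:
  fixes f :: "int \<Rightarrow> real"
  assumes const: "\<And>i. fdiff 2 f i = c" and bound: "\<And>i. \<bar>f i\<bar> \<le> C * wt i powr (3/2)"
  shows "c = 0"
proof -
  define A where "A = f 0"
  define B where "B = f 1 - f 0"
  have step: "f (i + 2) = 2 * f (i + 1) - f i + c" for i
    using const[of i] by (simp add: numeral_2_eq_2 add.assoc)
  have quad: "f (int n) = A + n * B + c * (n * (real n - 1) / 2)" for n
  proof (induction n rule: less_induct)
    case (less n)
    consider "n = 0" | "n = 1" | m where "n = Suc (Suc m)"
      by (metis One_nat_def not0_implies_Suc)
    then show ?case
    proof cases
      case 3
      have "f (int n) = 2 * f (int (Suc m)) - f (int m) + c"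
        using step[of "int m"] 3 by (simp add: add.commute)
      then show ?thesis using less[of m] less[of "Suc m"] 3
        by (simp add: field_simps)
    qed (auto simp: A_def B_def)
  qed
  have "\<bar>c\<bar> \<le> (C * (1 + real n) powr (3/2) + \<bar>A\<bar> + n * \<bar>B\<bar>) / (n * (real n - 1) / 2)"
    if "n \<ge> 2" for n
  proof -
    have pos: "n * (real n - 1) / 2 > 0" using that by simp
    have "\<bar>c\<bar> * (n * (real n - 1) / 2) = \<bar>f (int n) - A - n * B\<bar>"
      unfolding quad[of n] using pos by (simp only: abs_mult [of c] abs_of_pos add_diff_cancel_left' add.assoc)
    also have "\<dots> \<le> \<bar>f (int n)\<bar> + \<bar>A\<bar> + \<bar>n * B\<bar>" by linarith
    also have "\<dots> \<le> C * (1 + real n) powr (3/2) + \<bar>A\<bar> + n * \<bar>B\<bar>"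
      using bound[of "int n"] by (simp add: wt_def abs_mult)
    finally show ?thesis using pos by (subst pos_le_divide_eq) auto
  qed
  then have ev: "eventually (\<lambda>n. \<bar>c\<bar> \<le> (C * (1 + real n) powr (3/2) + \<bar>A\<bar> + n * \<bar>B\<bar>) / (n * (real n - 1) / 2)) sequentially"
    using eventually_sequentially by blast
  define D where "D n = n * (real n - 1) / 2" for n :: nat
  have "(\<lambda>n. (1 + real n) powr (3/2) / D n) \<longlonglongrightarrow> 0"
    "(\<lambda>n. 1 / D n) \<longlonglongrightarrow> 0" "(\<lambda>n. real n / D n) \<longlonglongrightarrow> 0"
    unfolding D_def by real_asymp+
  then have "(\<lambda>n. C * ((1 + real n) powr (3/2) / D n) + \<bar>A\<bar> * (1 / D n) + \<bar>B\<bar> * (real n / D n))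
      \<longlonglongrightarrow> C * 0 + \<bar>A\<bar> * 0 + \<bar>B\<bar> * 0"
    by (intro tendsto_intros)
  then have "(\<lambda>n. (C * (1 + real n) powr (3/2) + \<bar>A\<bar> + n * \<bar>B\<bar>) / D n) \<longlonglongrightarrow> 0"
    by (simp add: add_divide_distrib mult.commute)
  then have "(\<lambda>n. (C * (1 + real n) powr (3/2) + \<bar>A\<bar> + n * \<bar>B\<bar>) / (n * (real n - 1) / 2)) \<longlonglongrightarrow> 0"
    by (simp only: D_def)
  from tendsto_le[OF _ this tendsto_const ev] show ?thesis by simp
qed

text \<open>
  A polynomial of subquadratic growth is affine. The order of the vanishing difference is lowered
  one step at a time: if the difference of order \<open>M + 3\<close> vanishes, the one of order \<open>M + 2\<close> is the
  constant second difference of the \<open>M\<close>-th difference, which is again subquadratic.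
\<close>

lemma subquadratic_fdiff_zero:
  fixes f :: "int \<Rightarrow> real"
  assumes bound: "\<And>i. \<bar>f i\<bar> \<le> C * wt i powr (3/2)"
  shows "(\<And>i. fdiff (M + 2) f i = 0) \<Longrightarrow> fdiff 2 f i = 0"
proof (induction M arbitrary: i)
  case (Suc M)
  have step: "fdiff (M + 2) f (i + 1) = fdiff (M + 2) f i" for i
    using Suc.prems[of i] by simp
  have const: "fdiff 2 (fdiff M f) i = fdiff (M + 2) f 0" for i
  proof -
    have "fdiff (M + 2) f i = fdiff (M + 2) f 0"
    proof (induction i rule: int_induct[where k = 0])
      case (step1 i)
      then show ?case using step[of i] by metis
    next
      case (step2 i)
      then show ?case using step[of "i - 1"] by (metis diff_add_cancel)
    qed (rule refl)
    then show ?thesis by (metis fdiff_add add.commute)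
  qed
  obtain C' where "\<And>i. \<bar>fdiff M f i\<bar> \<le> C' * wt i powr (3/2)"
    using fdiff_growth[OF _ bound, of M] by auto
  from subquadratic_second_difference_zero[OF const this] have "fdiff (M + 2) f 0 = 0" .
  then have "fdiff (M + 2) f i = 0" for i
    using const[of i] by (metis fdiff_add add.commute)
  then show ?case by (rule Suc.IH)
next
  case 0
  from 0[of i] show ?case by (simp only: add_0)
qed

section \<open>The kernel and its regularized row sums\<close>

text \<open>
  Because \<open>0 powr - s = 0\<close>, the formula is zero for \<open>i = \<plusminus>j\<close>, which are the indices left out
  of the sum defining the operator.
\<close>

definition kernel :: "real \<Rightarrow> int \<Rightarrow> int \<Rightarrow> real" where
  "kernel s i j = real_of_int \<bar>i\<^sup>2 - j\<^sup>2\<bar> powr - s"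

lemma kernel_even [simp]: "kernel s (- i) j = kernel s i j" "kernel s i (- j) = kernel s i j"
  by (simp_all add: kernel_def)

lemma kernel_nonneg: "0 \<le> kernel s i j"
  by (simp add: kernel_def)

lemma kernel_le_1:
  assumes "0 \<le> s" shows "kernel s i j \<le> 1"
proof (cases "i\<^sup>2 = j\<^sup>2")
  case False
  then have "1 \<le> \<bar>i\<^sup>2 - j\<^sup>2\<bar>" by linarith
  then have "1 \<le> real_of_int \<bar>i\<^sup>2 - j\<^sup>2\<bar>" by linarith
  then have "1 \<le> real_of_int \<bar>i\<^sup>2 - j\<^sup>2\<bar> powr s"
    using assms by (rule ge_one_powr_ge_zero)
  then show ?thesis
    unfolding kernel_def powr_minus by (rule inverse_le_1_iff [THEN iffD2, OF disjI2])
qed (simp add: kernel_def)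

lemma kernel_diff_le_1:
  assumes "0 \<le> s" shows "\<bar>kernel s i j - kernel s 0 j\<bar> \<le> 1"
  using kernel_nonneg[of s i j] kernel_nonneg[of s 0 j]
    kernel_le_1[OF assms, of i j] kernel_le_1[OF assms, of 0 j] by linarith

text \<open>
  Comparing \<open>(j\<^sup>2 - i\<^sup>2) powr - s\<close> with \<open>(j\<^sup>2) powr - s\<close> amounts to bounding the \<open>s\<close>-th power of
  \<open>j\<^sup>2 / (j\<^sup>2 - i\<^sup>2)\<close>, and weighted arithmetic and geometric means give Bernoulli's inequality for the
  exponent \<open>s \<le> 1\<close>. The factor \<open>s\<close> gained in this way is essential for the sign of \<open>defect s 1\<close>.
\<close>

lemma kernel_diff_off_diagonal:
  assumes s: "0 \<le> s" "s \<le> 1" and ij: "\<bar>i\<bar> < \<bar>j\<bar>"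
  shows "0 \<le> kernel s i j - kernel s 0 j"
    and "kernel s i j - kernel s 0 j
       \<le> s * (real_of_int i)\<^sup>2 / ((real_of_int j)\<^sup>2 - (real_of_int i)\<^sup>2) * \<bar>real_of_int j\<bar> powr (- 2 * s)"
proof -
  define X where "X = (real_of_int j)\<^sup>2"
  define Y where "Y = (real_of_int i)\<^sup>2"
  have "i\<^sup>2 < j\<^sup>2" using ij by (simp add: abs_less_iff power2_strict_mono)
  then have "real_of_int (i\<^sup>2) < real_of_int (j\<^sup>2)" by (simp only: of_int_less_iff)
  then have YX: "Y < X" by (simp add: X_def Y_def)
  have Y0: "0 \<le> Y" by (simp add: Y_def)
  have j0: "\<bar>real_of_int j\<bar> > 0" using ij by auto
  have Ki: "kernel s i j = (X - Y) powr - s" 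
    using YX by (simp add: kernel_def X_def Y_def)
  have K0: "kernel s 0 j = X powr - s"
    by (simp add: kernel_def X_def)
  have Xp: "X powr - s = \<bar>real_of_int j\<bar> powr (- 2 * s)"
  proof -
    have "X = \<bar>real_of_int j\<bar> powr 2" using j0 by (simp add: X_def)
    then show ?thesis by (simp only: powr_powr) simp
  qed
  show "0 \<le> kernel s i j - kernel s 0 j"
    unfolding Ki K0 using YX Y0 s by (simp add: powr_mono2')
  have "(X - Y) powr - s = X powr - s * (X / (X - Y)) powr s"
    using YX Y0 by (simp add: powr_divide powr_minus_divide)
  also have "(X / (X - Y)) powr s * 1 powr (1 - s) \<le> s * (X / (X - Y)) + (1 - s) * 1"
    using s YX Y0 by (intro Youngs_inequality_0) auto
  then have "(X / (X - Y)) powr s \<le> 1 + s * Y / (X - Y)"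
    using YX by (simp add: field_simps)
  then have "X powr - s * (X / (X - Y)) powr s \<le> X powr - s * (1 + s * Y / (X - Y))"
    by (intro mult_left_mono) auto
  finally have "kernel s i j - kernel s 0 j \<le> s * Y / (X - Y) * X powr - s"
    unfolding Ki K0 by (simp add: algebra_simps)
  then show "kernel s i j - kernel s 0 j
       \<le> s * (real_of_int i)\<^sup>2 / ((real_of_int j)\<^sup>2 - (real_of_int i)\<^sup>2) * \<bar>real_of_int j\<bar> powr (- 2 * s)"
    unfolding Xp by (simp add: X_def Y_def)
qed

text \<open>
  Far from the diagonals this is the bound above. For \<open>\<bar>j\<bar> < 2 * \<bar>i\<bar>\<close> the ratio of the weights is
  at least \<open>1 / 2\<close>, and the constant \<open>8\<close> makes the right-hand side exceed the trivial bound \<open>1\<close>.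
\<close>

lemma kernel_diff_decay:
  assumes s: "0 \<le> s" "s \<le> 1 / 2"
  shows "\<bar>kernel s i j - kernel s 0 j\<bar> \<le> 8 * (wt i / wt j) powr (2 + 2 * s)"
proof (cases "\<bar>j\<bar> < 2 * \<bar>i\<bar> \<or> j = 0")
  case True
  then have "wt j \<le> 2 * wt i" by (auto simp: wt_def)
  then have "1 / 2 \<le> wt i / wt j" using wt_pos[of j] by (simp add: field_simps)
  then have "(1 / 2) powr (2 + 2 * s) \<le> (wt i / wt j) powr (2 + 2 * s)"
    using s by (intro powr_mono2) auto
  moreover have "(1 / 2) powr 3 \<le> (1 / 2 :: real) powr (2 + 2 * s)"
    using s by (intro powr_mono') auto
  moreover have "(1 / 2) powr 3 = (1 / 8 :: real)"
    by (simp add: power3_eq_cube)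
  ultimately have "1 \<le> 8 * (wt i / wt j) powr (2 + 2 * s)" by linarith
  then show ?thesis using kernel_diff_le_1[OF s(1), of i j] by linarith
next
  case False
  define I where "I = \<bar>real_of_int i\<bar>"
  define J where "J = \<bar>real_of_int j\<bar>"
  have IJ: "2 * I \<le> J" "0 \<le> I" "1 \<le> J" using False unfolding I_def J_def by linarith+
  have lt: "\<bar>i\<bar> < \<bar>j\<bar>" using False by linarith
  have sq: "4 * I\<^sup>2 \<le> J\<^sup>2"
    using power_mono[OF IJ(1), of 2] IJ(2) by (simp add: power_mult_distrib)
  have J2: "0 < J\<^sup>2" using IJ by simp
  have "s * I\<^sup>2 / (J\<^sup>2 - I\<^sup>2) \<le> I\<^sup>2 / J\<^sup>2"
  proof -
    have "s * I\<^sup>2 / (J\<^sup>2 - I\<^sup>2) \<le> (1 / 2) * I\<^sup>2 / (J\<^sup>2 / 2)"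
      using s sq J2 zero_le_power2[of I] by (intro frac_le mult_right_mono) (linarith | simp)+
    then show ?thesis by simp
  qed
  then have "s * I\<^sup>2 / (J\<^sup>2 - I\<^sup>2) * J powr (- 2 * s) \<le> I\<^sup>2 / J\<^sup>2 * J powr (- 2 * s)"
    by (intro mult_right_mono) auto
  also have "\<dots> \<le> 8 * ((I / (2 * J))\<^sup>2 * (1 / (2 * J)) powr (2 * s))"
  proof -
    have "(1 / 2) powr 1 \<le> (1 / 2 :: real) powr (2 * s)"
      using s by (intro powr_mono') auto
    then have "1 / 2 * J powr (- 2 * s) \<le> (1 / 2) powr (2 * s) * J powr (- 2 * s)"
      by (intro mult_right_mono) auto
    also have "\<dots> = (1 / (2 * J)) powr (2 * s)"
      using IJ by (simp add: powr_divide powr_mult powr_minus_divide)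
    finally have "2 * (I\<^sup>2 / J\<^sup>2) * (1 / 2 * J powr (- 2 * s)) \<le> 2 * (I\<^sup>2 / J\<^sup>2) * (1 / (2 * J)) powr (2 * s)"
      by (intro mult_left_mono) auto
    then show ?thesis by (simp add: power_divide power_mult_distrib)
  qed
  also have "\<dots> \<le> 8 * ((wt i / wt j)\<^sup>2 * (wt i / wt j) powr (2 * s))"
  proof -
    have "I / (2 * J) \<le> wt i / wt j" "1 / (2 * J) \<le> wt i / wt j"
      using IJ by (auto intro!: frac_le simp: wt_def I_def J_def)
    then show ?thesis
      using IJ s by (intro mult_left_mono mult_mono power_mono powr_mono2) auto
  qed
  also have "\<dots> = 8 * (wt i / wt j) powr (2 + 2 * s)"
    using wt_pos[of i] wt_pos[of j] by (simp add: powr_add)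
  finally show ?thesis
    using kernel_diff_off_diagonal[OF _ _ lt, of s] s by (simp add: I_def J_def)
qed

text \<open>
  The exponent \<open>3 / 2\<close> is chosen strictly between \<open>1\<close>, so that the sum over \<open>j\<close> converges, and
  \<open>2\<close>, so that the resulting growth in \<open>i\<close> is subquadratic.
\<close>

lemma kernel_diff_growth:
  assumes s: "0 \<le> s" "s \<le> 1 / 2"
  shows "\<bar>kernel s i j - kernel s 0 j\<bar> \<le> 8 * (wt i / wt j) powr (3 / 2)"
proof (cases "wt i / wt j \<le> 1")
  case True
  then have "(wt i / wt j) powr (2 + 2 * s) \<le> (wt i / wt j) powr (3 / 2)"
    using s wt_nonneg by (intro powr_mono') auto
  then show ?thesis using kernel_diff_decay[OF s, of i j] by linarith
next
  case False
  then have "1 \<le> (wt i / wt j) powr (3 / 2)"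
    by (intro ge_one_powr_ge_zero) auto
  then show ?thesis using kernel_diff_le_1[OF s(1), of i j] by linarith
qed

text \<open>
  The sum of row \<open>i\<close>, regularized by subtracting row \<open>0\<close>: for \<open>s \<le> 1 / 2\<close> neither row is
  summable by itself. A sequence of sum zero cannot feel the subtraction.
\<close>

definition defect :: "real \<Rightarrow> int \<Rightarrow> real" where
  "defect s i = (\<Sum>\<^sub>\<infinity>j. kernel s i j - kernel s 0 j)"

lemma defect_has_sum:
  assumes s: "0 \<le> s" "s \<le> 1 / 2"
  shows "((\<lambda>j. kernel s i j - kernel s 0 j) has_sum defect s i) UNIV"
proof -
  have "(\<lambda>j. 8 * wt i powr (3 / 2) * wt j powr - (3 / 2)) summable_on UNIV"
    by (intro summable_on_cmult_right wt_powr_summable) simp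
  then have "(\<lambda>j. norm (kernel s i j - kernel s 0 j)) summable_on UNIV"
  proof (rule summable_on_comparison_test)
    show "norm (kernel s i j - kernel s 0 j) \<le> 8 * wt i powr (3 / 2) * wt j powr - (3 / 2)" for j
      using kernel_diff_growth[OF s, of i j] by (simp add: wt_ratio_powr mult.assoc)
  qed simp
  then have "(\<lambda>j. kernel s i j - kernel s 0 j) summable_on UNIV"
    by (rule abs_summable_summable)
  then show ?thesis unfolding defect_def by (rule has_sum_infsum)
qed

lemma defect_0 [simp]: "defect s 0 = 0"
  by (simp add: defect_def)

lemma defect_even [simp]: "defect s (- i) = defect s i"
  by (simp add: defect_def)

lemma defect_growth:
  assumes s: "0 \<le> s" "s \<le> 1 / 2"
  shows "\<exists>C. \<forall>i. \<bar>defect s i\<bar> \<le> C * wt i powr (3 / 2)"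
proof -
  obtain S where S: "((\<lambda>j. wt j powr - (3 / 2)) has_sum S) UNIV"
    using wt_powr_summable[of "3/2"] by (auto simp: summable_on_def)
  have "\<bar>defect s i\<bar> \<le> 8 * S * wt i powr (3 / 2)" for i
  proof -
    have "norm (defect s i) \<le> 8 * wt i powr (3 / 2) * S"
    proof (rule norm_infsum_le[OF defect_has_sum[OF s] has_sum_cmult_right[OF S]])
      show "norm (kernel s i j - kernel s 0 j) \<le> 8 * wt i powr (3 / 2) * wt j powr - (3 / 2)" for j
        using kernel_diff_growth[OF s, of i j] by (simp add: wt_ratio_powr mult.assoc)
    qed
    then show ?thesis by (simp add: mult_ac)
  qed
  then show ?thesis by blast
qed

text \<open>
  The column \<open>j = 0\<close> contributes \<open>1\<close> and the columns \<open>j = \<plusminus>1\<close> contribute \<open>-1\<close> each. By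
  Bernoulli's inequality, any other column contributes at most \<open>s / (j\<^sup>2 - 1) \<le> 1 / (2 * (j\<^sup>2 - 1))\<close>,
  and these bounds telescope to a total of \<open>3 / 4 < 1\<close>.
\<close>

lemma defect_1_neg:
  assumes s: "0 \<le> s" "s \<le> 1 / 2"
  shows "defect s 1 < 0"
proof -
  define f where "f j = kernel s 1 j - kernel s 0 j" for j
  define v where "v n = (1 / (real n + 1) + 1 / (real n + 2)) / 4" for n
  \<comment> \<open>The bound for column \<open>n + 1\<close>; the difference \<open>v (n - 1) - v n\<close> equals \<open>1 / (2 * ((n + 1)\<^sup>2 - 1))\<close>.\<close>
  define g where "g n = (if n = 0 then -1 else v (n - 1) - v n)" for n :: nat
  have fd: "(f has_sum defect s 1) UNIV"
    unfolding f_def by (rule defect_has_sum[OF s])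
  then have "f summable_on UNIV" by (rule has_sum_imp_summable)
  then have "f summable_on range (\<lambda>n. int (Suc n))"
    by (rule summable_on_subset) auto
  then have "(\<lambda>n. f (int (Suc n))) summable_on UNIV"
    by (subst (asm) summable_on_reindex) (auto simp: inj_on_def o_def)
  then obtain S where S: "((\<lambda>n. f (int (Suc n))) has_sum S) UNIV"
    by (auto simp: summable_on_def)
  have "(f has_sum (f 0 + 2 * S)) UNIV"
    by (rule has_sum_int_even[OF _ S]) (simp add: f_def)
  then have d: "defect s 1 = f 0 + 2 * S"
    using fd has_sum_unique by blast
  have "v \<longlonglongrightarrow> 0" unfolding v_def by real_asymp
  then have "(\<lambda>n. v n - v (Suc n)) sums (v 0 - 0)"
    by (rule telescope_sums')
  then have "(\<lambda>n. g (Suc n)) sums (3 / 8)"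
    by (simp add: g_def v_def)
  then have g: "g sums (3 / 8 + g 0)"
    by (rule sums_Suc_iff[THEN iffD1])
  have le: "f (int (Suc n)) \<le> g n" for n
  proof (cases n)
    case 0
    then show ?thesis by (simp add: f_def g_def kernel_def)
  next
    case (Suc m)
    define J where "J = real (Suc n)"
    have J: "J\<^sup>2 - 1 = (real m + 1) * (real m + 3)"
      using Suc by (simp add: J_def power2_eq_square algebra_simps)
    have "f (int (Suc n)) \<le> s / (J\<^sup>2 - 1) * J powr (- 2 * s)"
      using kernel_diff_off_diagonal(2)[of s 1 "int (Suc n)"] s Suc by (simp add: f_def J_def)
    also have "\<dots> \<le> (1 / 2) / (J\<^sup>2 - 1) * 1"
    proof (intro mult_mono divide_right_mono)
      have "J powr (- 2 * s) \<le> J powr 0"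
        using s by (intro powr_mono) (auto simp: J_def)
      then show "J powr (- 2 * s) \<le> 1" by (simp add: J_def)
    qed (use s in \<open>auto simp: J\<close>)
    also have "\<dots> = g n"
      unfolding J using Suc by (simp add: g_def v_def divide_simps) (simp add: algebra_simps)
    finally show ?thesis .
  qed
  have "S \<le> 3 / 8 + g 0"
    using le has_sum_imp_sums[OF S] g by (rule sums_le)
  moreover have "f 0 = 1" by (simp add: f_def kernel_def)
  ultimately show ?thesis using d by (simp add: g_def)
qed

section \<open>Test sequences with vanishing moments\<close>

text \<open>
  The coefficients of the functional \<open>\<phi> \<mapsto> fdiff M \<phi> a\<close>, i.e. an alternating row of binomial
  coefficients placed at \<open>a, \<dots>, a + M\<close>.
\<close>

definition test_seq :: "nat \<Rightarrow> int \<Rightarrow> int \<Rightarrow> complex" where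
  "test_seq M a i = fdiff M (\<lambda>k. of_bool (i = k)) a"

lemma test_seq_has_sum: "((\<lambda>i. test_seq M a i * \<phi> i) has_sum fdiff M \<phi> a) UNIV"
proof -
  have "((\<lambda>i. of_bool (i = k) * \<phi> i) has_sum \<phi> k) UNIV" for k
    by (rule has_sum_finite_neutralI[of "{k}"]) auto
  then have "((\<lambda>i. fdiff M (\<lambda>k. of_bool (i = k) * \<phi> i) a) has_sum fdiff M \<phi> a) UNIV"
    by (rule has_sum_fdiff)
  moreover have "test_seq M a i * \<phi> i = fdiff M (\<lambda>k. of_bool (i = k) * \<phi> i) a" for i
    unfolding test_seq_def by (rule fdiff_additive) (rule left_diff_distrib)
  ultimately show ?thesis by simp
qed

lemma test_seq_support: "i \<notin> {a..a + int M} \<Longrightarrow> test_seq M a i = 0"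
proof (induction M arbitrary: a)
  case (Suc M)
  have "test_seq M (a + 1) i = 0" "test_seq M a i = 0"
    by (rule Suc.IH; use Suc.prems in auto)+
  then show ?case by (simp add: test_seq_def)
qed (simp add: test_seq_def)

lemma discrete_Hilbert_test_seq:
  "discrete_Hilbert (test_seq M a) j
     = 1 / of_real pi * ((-1) ^ M * fact M / pochhammer (of_int j + 1 / 2 + of_int a) (Suc M))"
proof -
  have nz: "(of_int j + 1 / 2 :: complex) + of_int i \<noteq> 0" for i
  proof
    assume "(of_int j + 1 / 2 :: complex) + of_int i = 0"
    then have "Re (of_int j + 1 / 2 + of_int i) = 0" by (simp only: zero_complex.sel)
    then show False using half_le_abs[of j i] by (simp add: algebra_simps)
  qed
  have "infsum (\<lambda>i. test_seq M a i / (of_int j + of_int i + 1 / 2)) UNIV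
      = infsum (\<lambda>i. test_seq M a i * (1 / (of_int j + 1 / 2 + of_int i))) UNIV"
    by (simp add: algebra_simps)
  also have "\<dots> = fdiff M (\<lambda>i. 1 / (of_int j + 1 / 2 + of_int i)) a"
    by (rule infsumI[OF test_seq_has_sum])
  also have "\<dots> = (-1) ^ M * fact M / pochhammer (of_int j + 1 / 2 + of_int a) (Suc M)"
    by (rule fdiff_inverse_shift[OF nz])
  finally show ?thesis by (simp only: discrete_Hilbert_def)
qed

lemma norm_half_shift: "norm (of_int j + of_int i + 1 / 2 :: complex) = \<bar>real_of_int j + real_of_int i + 1 / 2\<bar>"
proof -
  have "(of_int j + of_int i + 1 / 2 :: complex) = of_real (real_of_int j + real_of_int i + 1 / 2)"
    by simp
  then show ?thesis by (simp only: norm_of_real)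
qed

lemma discrete_Hilbert_test_seq_decay:
  "\<exists>C. 0 \<le> C \<and> (\<forall>j. norm (discrete_Hilbert (test_seq M a) j) \<le> C * wt j powr - real (Suc M))"
proof -
  define P where "P = (\<Prod>k<Suc M. 4 * wt (a + int k))"
  have "norm (discrete_Hilbert (test_seq M a) j) \<le> 1 / pi * fact M * P * wt j powr - real (Suc M)" for j
  proof -
    have "norm (1 / pochhammer (of_int j + 1 / 2 + of_int a :: complex) (Suc M))
        = (\<Prod>k<Suc M. 1 / norm (of_int j + of_int (a + int k) + 1 / 2 :: complex))"
      unfolding pochhammer_prod norm_divide norm_one
      by (simp add: prod_norm[symmetric] prod_dividef atLeast0LessThan algebra_simps del: prod.lessThan_Suc)
    also have "\<dots> \<le> (\<Prod>k<Suc M. 4 * (wt (a + int k) / wt j))"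
      by (intro prod_mono) (simp only: norm_half_shift inverse_half_shift_le, simp)
    also have "\<dots> = P * wt j powr - real (Suc M)"
      using wt_pos[of j] by (simp add: P_def prod_dividef powr_minus_divide powr_realpow del: prod.lessThan_Suc of_nat_Suc power_Suc)
    finally have "1 / pi * fact M * norm (1 / pochhammer (of_int j + 1 / 2 + of_int a :: complex) (Suc M))
        \<le> 1 / pi * fact M * (P * wt j powr - real (Suc M))"
      by (intro mult_left_mono) auto
    then show ?thesis
      by (simp add: discrete_Hilbert_test_seq norm_mult norm_divide norm_power del: of_nat_Suc pochhammer_Suc)
  qed
  moreover have "0 \<le> 1 / pi * fact M * P"
    unfolding P_def by (intro mult_nonneg_nonneg prod_nonneg) (auto simp: wt_nonneg)
  ultimately show ?thesis by blast
qed

text \<open>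
  Finite support settles the sequence itself, and the decay of order \<open>M + 1\<close> its transform.
\<close>

lemma test_seq_in_Hardy_space:
  assumes p: "0 < p" and M: "1 < real (Suc M) * p"
  shows "test_seq M a \<in> Hardy_space p"
proof -
  have "{i. norm (test_seq M a i) powr p \<noteq> 0} \<subseteq> {a..a + int M}"
    using test_seq_support[of _ a M] by fastforce
  then have "finite {i. norm (test_seq M a i) powr p \<noteq> 0}"
    by (rule finite_subset) simp
  then have 1: "test_seq M a \<in> lp_space p"
    unfolding lp_space_def by (simp add: finite_nonzero_values_imp_summable_on)
  obtain C where C: "0 \<le> C" "\<And>j. norm (discrete_Hilbert (test_seq M a) j) \<le> C * wt j powr - real (Suc M)"
    using discrete_Hilbert_test_seq_decay by blast
  have "(\<lambda>j. C powr p * wt j powr - (real (Suc M) * p)) summable_on UNIV"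
    using M by (intro summable_on_cmult_right wt_powr_summable)
  then have "(\<lambda>j. norm (discrete_Hilbert (test_seq M a) j) powr p) summable_on UNIV"
  proof (rule summable_on_comparison_test)
    fix j
    have "norm (discrete_Hilbert (test_seq M a) j) powr p \<le> (C * wt j powr - real (Suc M)) powr p"
      using p C by (intro powr_mono2) auto
    also have "\<dots> = C powr p * wt j powr - (real (Suc M) * p)"
      using C by (simp only: powr_mult powr_powr minus_mult_left)
    finally show "norm (discrete_Hilbert (test_seq M a) j) powr p \<le> C powr p * wt j powr - (real (Suc M) * p)" .
  qed simp
  with 1 show ?thesis by (simp add: Hardy_space_def lp_space_def)
qed

section \<open>The operator on test sequences\<close>

lemma U_op_test_seq:
  "U_op \<gamma> (test_seq M a) j = of_real (fdiff M (\<lambda>i. kernel ((1 - \<gamma>) / 2) i j) a)"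
proof -
  define s where "s = (1 - \<gamma>) / 2"
  have "U_op \<gamma> (test_seq M a) j = infsum (\<lambda>i. test_seq M a i * of_real (kernel s i j)) UNIV"
    unfolding U_op_def s_def[symmetric]
  proof (rule infsum_cong_neutral)
    fix i assume "i \<in> UNIV - {i. i \<noteq> j \<and> i \<noteq> - j}"
    then show "test_seq M a i * of_real (kernel s i j) = 0"
      by (auto simp: kernel_def)
  next
    fix i
    have "\<bar>i\<^sup>2 - j\<^sup>2\<bar> = \<bar>i - j\<bar> * \<bar>i + j\<bar>"
      by (simp add: abs_mult[symmetric] power2_eq_square algebra_simps)
    then have "kernel s i j = 1 / (real_of_int \<bar>i - j\<bar> powr s * real_of_int \<bar>i + j\<bar> powr s)"
      unfolding kernel_def by (simp add: powr_mult powr_minus_divide)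
    then show "test_seq M a i / of_real (real_of_int \<bar>i - j\<bar> powr s * real_of_int \<bar>i + j\<bar> powr s)
        = test_seq M a i * of_real (kernel s i j)"
      by simp
  qed auto
  also have "\<dots> = fdiff M (\<lambda>i. of_real (kernel s i j)) a"
    by (rule infsumI[OF test_seq_has_sum])
  also have "\<dots> = of_real (fdiff M (\<lambda>i. kernel s i j) a)"
    by (rule fdiff_additive[symmetric]) (rule of_real_diff)
  finally show ?thesis by (simp only: s_def)
qed

text \<open>
  At least one difference is taken, so row \<open>0\<close> can be subtracted for free. This makes each of
  the finitely many rows involved summable and allows summation row by row.
\<close>

lemma U_op_test_seq_has_sum:
  assumes \<gamma>: "0 \<le> \<gamma>" "\<gamma> \<le> 1"
  shows "(U_op \<gamma> (test_seq (Suc M) a) has_sum of_real (fdiff (Suc M) (defect ((1 - \<gamma>) / 2)) a)) UNIV"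
proof -
  have "((\<lambda>j. fdiff (Suc M) (\<lambda>i. kernel ((1 - \<gamma>) / 2) i j - kernel ((1 - \<gamma>) / 2) 0 j) a)
      has_sum fdiff (Suc M) (defect ((1 - \<gamma>) / 2)) a) UNIV"
    using \<gamma> by (intro has_sum_fdiff defect_has_sum) auto
  then show ?thesis
    unfolding U_op_test_seq fdiff_Suc_minus_const by (rule has_sum_of_real)
qed

lemma U_op_test_seq_decay:
  assumes \<gamma>: "0 \<le> \<gamma>" "\<gamma> \<le> 1"
  shows "\<exists>C. \<forall>j. norm (U_op \<gamma> (test_seq (Suc M) a) j) \<le> C * wt j powr - (3 - \<gamma>)"
proof -
  let ?s = "(1 - \<gamma>) / 2"
  have "\<exists>C. \<forall>j. norm (kernel ?s i j - kernel ?s 0 j) \<le> C * wt j powr - (3 - \<gamma>)" for i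
  proof (intro exI allI)
    fix j
    have "norm (kernel ?s i j - kernel ?s 0 j) \<le> 8 * (wt i / wt j) powr (2 + 2 * ?s)"
      using kernel_diff_decay[of ?s i j] \<gamma> by simp
    also have "2 + 2 * ?s = 3 - \<gamma>" by simp
    also have "8 * (wt i / wt j) powr (3 - \<gamma>) = 8 * wt i powr (3 - \<gamma>) * wt j powr - (3 - \<gamma>)"
      by (simp add: wt_ratio_powr)
    finally show "norm (kernel ?s i j - kernel ?s 0 j) \<le> 8 * wt i powr (3 - \<gamma>) * wt j powr - (3 - \<gamma>)" .
  qed
  from fdiff_norm_bound[where F = "\<lambda>i j. kernel ?s i j - kernel ?s 0 j" and M = "Suc M" and a = a, OF this]
  show ?thesis
    unfolding U_op_test_seq fdiff_Suc_minus_const norm_of_real real_norm_def .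
qed

section \<open>Cancellation forced by membership in the Hardy space\<close>

text \<open>
  The inclusion of \<open>\<ell>\<^sup>q\<close> in \<open>\<ell>\<^sup>1\<close>: each term is at most \<open>N powr (1 / q)\<close>, where \<open>N\<close> is the full
  sum of \<open>q\<close>-th powers, so writing \<open>t = t powr q * t powr (1 - q)\<close> compares the two series.
\<close>

lemma lp_space_norm_summable:
  assumes q: "0 < q" "q \<le> 1" and f: "f \<in> lp_space q"
  shows "(\<lambda>j. norm (f j)) summable_on UNIV"
proof -
  define N where "N = (\<Sum>\<^sub>\<infinity>j. norm (f j) powr q)"
  have sm: "(\<lambda>j. norm (f j) powr q) summable_on UNIV"
    using f by (simp add: lp_space_def)
  then have "(\<lambda>j. norm (f j) powr q * N powr ((1 - q) / q)) summable_on UNIV"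
    by (rule summable_on_cmult_left)
  then show ?thesis
  proof (rule summable_on_comparison_test)
    fix j
    have "(\<Sum>j\<in>{j}. norm (f j) powr q) \<le> N"
      unfolding N_def by (rule finite_sum_le_infsum[OF sm]) auto
    then have "(norm (f j) powr q) powr ((1 - q) / q) \<le> N powr ((1 - q) / q)"
      using q by (intro powr_mono2) auto
    then have "norm (f j) powr (1 - q) \<le> N powr ((1 - q) / q)"
      using q by (simp add: powr_powr)
    then have "norm (f j) powr q * norm (f j) powr (1 - q) \<le> norm (f j) powr q * N powr ((1 - q) / q)"
      by (rule mult_left_mono) simp
    then show "norm (f j) \<le> norm (f j) powr q * N powr ((1 - q) / q)"
      by (simp add: powr_add[symmetric])
  qed simp
qed

text \<open>
  With \<open>x = j + i + 1 / 2\<close> and \<open>T = \<pi> H f\<close>, the identity \<open>(j + 1 / 2) / x = 1 - i / x\<close> gives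
  \<open>S = (j + 1 / 2) * T j + (\<Sum>i. f i * i / x)\<close>. The decay of \<open>f\<close> leaves room for a factor
  \<open>wt i powr (e / 2)\<close> in the last sum, which interpolation between the bounds \<open>2\<close> and
  \<open>4 * wt i / wt j\<close> for \<open>1 / \<bar>x\<bar>\<close> turns into decay in \<open>j\<close>. Dividing by \<open>wt j\<close>, a nonzero \<open>S\<close>
  bounds the harmonic series by two convergent ones.
\<close>

lemma sum_zero_of_discrete_Hilbert_in_lp:
  assumes e: "0 < e" "e \<le> 2" and q: "0 < q" "q \<le> 1"
    and decay: "\<And>j. norm (f j) \<le> C * wt j powr - (2 + e)"
    and S: "(f has_sum S) UNIV" and H: "discrete_Hilbert f \<in> lp_space q"
  shows "S = 0"
proof (rule ccontr)
  assume "S \<noteq> 0"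
  define x :: "int \<Rightarrow> int \<Rightarrow> complex" where "x j i = of_int j + of_int i + 1 / 2" for j i
  define T where "T j = (\<Sum>\<^sub>\<infinity>i. f i / x j i)" for j
  have C0: "0 \<le> C" using order_trans[OF norm_ge_zero decay[of 0]] by (simp add: wt_def)
  have nx: "norm (x j i) = \<bar>real_of_int j + real_of_int i + 1 / 2\<bar>" for j i
    by (simp add: x_def norm_half_shift)
  have x_ge: "1 / 2 \<le> norm (x j i)" for j i unfolding nx by (rule half_le_abs)
  then have x_nz: "x j i \<noteq> 0" for j i by (metis norm_zero not_le half_gt_zero zero_less_one)
  obtain B where B: "((\<lambda>i. wt i powr - (1 + e / 2)) has_sum B) UNIV"
    using wt_powr_summable[of "1 + e / 2"] e by (auto simp: summable_on_def)
  have inv_x: "1 / norm (x j i) \<le> 4 * (wt i powr (e / 2) * wt j powr - (e / 2))" for j i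
  proof -
    have "1 / norm (x j i) \<le> 4 * (wt i / wt j) powr (e / 2)"
    proof (cases "wt i / wt j \<le> 1")
      case True
      have "(wt i / wt j) powr 1 \<le> (wt i / wt j) powr (e / 2)"
        using True e wt_nonneg by (intro powr_mono') auto
      then show ?thesis using inverse_half_shift_le[of j i] wt_nonneg[of i] wt_nonneg[of j]
        unfolding nx[symmetric] by simp
    next
      case False
      then have "1 \<le> (wt i / wt j) powr (e / 2)"
        using e by (intro ge_one_powr_ge_zero) auto
      moreover have "1 / norm (x j i) \<le> 1 / (1 / 2)"
        using x_ge[of j i] by (intro divide_left_mono) (auto simp: x_nz)
      ultimately show ?thesis by simp
    qed
    then show ?thesis by (simp only: wt_ratio_powr)
  qed
  have fs: "(\<lambda>i. f i / x j i) summable_on UNIV" for j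
  proof (rule abs_summable_summable)
    have "(\<lambda>i. 2 * C * wt i powr - (2 + e)) summable_on UNIV"
      using e by (intro summable_on_cmult_right wt_powr_summable) auto
    then show "(\<lambda>i. norm (f i / x j i)) summable_on UNIV"
    proof (rule summable_on_comparison_test)
      fix i
      have "norm (f i / x j i) \<le> (C * wt i powr - (2 + e)) / (1 / 2)"
        unfolding norm_divide using x_ge[of j i] C0 by (intro frac_le decay) auto
      then show "norm (f i / x j i) \<le> 2 * C * wt i powr - (2 + e)" by simp
    qed simp
  qed
  have key: "norm S \<le> wt j * norm (T j) + 4 * C * B * wt j powr - (e / 2)" for j
  proof -
    have hs: "((\<lambda>i. f i / x j i) has_sum T j) UNIV"
      unfolding T_def by (rule has_sum_infsum[OF fs])
    have "((\<lambda>i. f i + - ((of_int j + 1 / 2) * (f i / x j i))) has_sum (S + - ((of_int j + 1 / 2) * T j))) UNIV"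
      by (intro has_sum_add S) (simp only: has_sum_uminus minus_minus has_sum_cmult_right[OF hs])
    moreover have "f i + - ((of_int j + 1 / 2) * (f i / x j i)) = f i * of_int i / x j i" for i
    proof -
      have "f i + - ((of_int j + 1 / 2) * (f i / x j i)) = f i * (x j i - (of_int j + 1 / 2)) / x j i"
        using x_nz[of j i] by (simp add: field_simps)
      then show ?thesis by (simp add: x_def)
    qed
    ultimately have "((\<lambda>i. f i * of_int i / x j i) has_sum (S + - ((of_int j + 1 / 2) * T j))) UNIV"
      by simp
    then have "norm (S + - ((of_int j + 1 / 2) * T j)) \<le> 4 * C * wt j powr - (e / 2) * B"
    proof (rule norm_infsum_le[OF _ has_sum_cmult_right[OF B]])
      fix i
      have "norm (f i * of_int i / x j i) = norm (f i) * \<bar>real_of_int i\<bar> * (1 / norm (x j i))"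
        by (simp add: norm_divide norm_mult)
      also have "\<dots> \<le> (C * wt i powr - (2 + e)) * wt i powr 1 * (4 * (wt i powr (e / 2) * wt j powr - (e / 2)))"
        using C0 by (intro mult_mono decay inv_x mult_nonneg_nonneg) (auto simp: wt_def)
      also have "\<dots> = 4 * C * wt j powr - (e / 2) * (wt i powr - (2 + e) * wt i powr 1 * wt i powr (e / 2))"
        by (simp only: mult_ac)
      also have "wt i powr - (2 + e) * wt i powr 1 * wt i powr (e / 2) = wt i powr - (1 + e / 2)"
      proof -
        have "- (2 + e) + 1 + e / 2 = - (1 + e / 2)" by linarith
        then show ?thesis by (simp only: powr_add[symmetric])
      qed
      finally show "norm (f i * of_int i / x j i) \<le> 4 * C * wt j powr - (e / 2) * wt i powr - (1 + e / 2)" .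
    qed
    moreover have "norm S \<le> norm (S + - ((of_int j + 1 / 2) * T j)) + norm ((of_int j + 1 / 2) * T j)"
      using norm_triangle_ineq[of "S + - ((of_int j + 1 / 2) * T j)" "(of_int j + 1 / 2) * T j"] by simp
    moreover have "norm ((of_int j + 1 / 2) * T j) \<le> wt j * norm (T j)"
    proof -
      have "norm (of_int j + 1 / 2 :: complex) \<le> norm (of_int j :: complex) + norm (1 / 2 :: complex)"
        by (rule norm_triangle_ineq)
      then have "norm (of_int j + 1 / 2 :: complex) \<le> wt j"
        by (simp add: wt_def)
      then show ?thesis by (simp add: norm_mult mult_right_mono)
    qed
    ultimately show ?thesis by (simp add: mult_ac)
  qed
  have Hs: "(\<lambda>j. norm (discrete_Hilbert f j)) summable_on UNIV"
    by (rule lp_space_norm_summable[OF q H])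
  have "norm (T j) = pi * norm (discrete_Hilbert f j)" for j
    by (simp add: discrete_Hilbert_def T_def x_def norm_mult norm_divide)
  then have "(\<lambda>j. norm (T j)) summable_on UNIV"
    using summable_on_cmult_right[OF Hs, of pi] by simp
  moreover have "(\<lambda>j. 4 * C * B * wt j powr - (1 + e / 2)) summable_on UNIV"
    using e by (intro summable_on_cmult_right wt_powr_summable) auto
  ultimately have "(\<lambda>j. norm (T j) + 4 * C * B * wt j powr - (1 + e / 2)) summable_on UNIV"
    by (rule summable_on_add)
  then have "(\<lambda>j. norm S * (1 / wt j)) summable_on UNIV"
  proof (rule summable_on_comparison_test)
    fix j
    have eq: "wt j powr - (1 + e / 2) = wt j powr - (e / 2) / wt j"
    proof -
      have "- (1 + e / 2) = - (e / 2) - 1" by linarith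
      then show ?thesis using wt_nonneg[of j] by (simp only: powr_diff powr_one)
    qed
    have "norm S / wt j \<le> (wt j * norm (T j) + 4 * C * B * wt j powr - (e / 2)) / wt j"
      by (intro divide_right_mono key wt_nonneg)
    then show "norm S * (1 / wt j) \<le> norm (T j) + 4 * C * B * wt j powr - (1 + e / 2)"
      unfolding eq by (simp add: add_divide_distrib wt_nz)
  qed (simp add: wt_nonneg)
  then have "(\<lambda>j. 1 / norm S * (norm S * (1 / wt j))) summable_on UNIV"
    by (rule summable_on_cmult_right)
  then show False using wt_inverse_not_summable \<open>S \<noteq> 0\<close> by simp
qed

theorem mainTheorem3:
  "\<exists>\<epsilon>::real. 0 < \<epsilon> \<and> \<epsilon> < 1 / 3 \<and>
     (\<forall>\<gamma>::real. 0 \<le> \<gamma> \<and> \<gamma> < \<epsilon> \<longrightarrow>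
       (\<forall>p q::real. 0 < p \<and> p \<le> 1 / (1 + \<gamma>) \<and> 1 / q = 1 / p - \<gamma> \<longrightarrow>
          \<not> Hardy_bounded p q (U_op \<gamma>)))"
proof (intro exI[of _ "1 / 4 :: real"] conjI allI impI notI)
  fix \<gamma> p q :: real
  assume \<gamma>: "0 \<le> \<gamma> \<and> \<gamma> < 1 / 4"
    and pq: "0 < p \<and> p \<le> 1 / (1 + \<gamma>) \<and> 1 / q = 1 / p - \<gamma>"
    and bounded: "Hardy_bounded p q (U_op \<gamma>)"
  define s where "s = (1 - \<gamma>) / 2"
  have s: "0 \<le> s" "s \<le> 1 / 2" using \<gamma> by (auto simp: s_def)
  \<comment> \<open>The hypothesis on \<open>p\<close> is equivalent to \<open>q \<le> 1\<close>.\<close>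
  have "1 + \<gamma> \<le> 1 / p" using pq \<gamma> by (simp add: field_simps)
  then have "1 \<le> 1 / q" using pq by simp
  then have q: "0 < q" "q \<le> 1"
    by (auto simp: le_divide_eq_1)
  obtain M where "1 / p < real M"
    using reals_Archimedean2 by blast
  then have "1 < real M * p" using pq by (simp add: field_simps)
  then have Mp: "1 < real (Suc (M + 2)) * p"
    using pq by (simp add: algebra_simps)
  have zero: "fdiff (M + 2) (defect s) a = 0" for a
  proof -
    let ?f = "U_op \<gamma> (test_seq (Suc (M + 1)) a)"
    have "test_seq (Suc (M + 1)) a \<in> Hardy_space p"
      using pq Mp by (intro test_seq_in_Hardy_space) auto
    then have "?f \<in> Hardy_space q"
      using bounded by (simp add: Hardy_bounded_def)
    then have H: "discrete_Hilbert ?f \<in> lp_space q"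
      by (simp add: Hardy_space_def)
    obtain C where C: "\<And>j. norm (?f j) \<le> C * wt j powr - (2 + (1 - \<gamma>))"
      using U_op_test_seq_decay[of \<gamma> "M + 1" a] \<gamma> by auto
    have sum: "(?f has_sum of_real (fdiff (Suc (M + 1)) (defect s) a)) UNIV"
      unfolding s_def using \<gamma> by (intro U_op_test_seq_has_sum) auto
    have "of_real (fdiff (Suc (M + 1)) (defect s) a) = (0 :: complex)"
      using \<gamma> by (intro sum_zero_of_discrete_Hilbert_in_lp[OF _ _ q C sum H]) auto
    then show ?thesis by (simp only: of_real_eq_0_iff) simp
  qed
  obtain C where "\<And>i. \<bar>defect s i\<bar> \<le> C * wt i powr (3 / 2)"
    using defect_growth[OF s] by blast
  \<comment> \<open>The second difference at \<open>- 1\<close> is \<open>d 1 - 2 * d 0 + d (- 1)\<close>, which evenness makes \<open>2 * d 1\<close>.\<close>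
  from subquadratic_fdiff_zero[OF this zero] have "fdiff 2 (defect s) (- 1) = 0" .
  then have "defect s 1 + defect s (- 1) = 0"
    by (simp add: numeral_2_eq_2)
  then show False using defect_1_neg[OF s] by simp
qed auto

end
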